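(* For any $n,k\in\mathbb{N}$, $\rho_k^n\ge 1+c_k$.
   Context: Let $\mathcal{C}$ be the unit circle in the Euclidean plane centered at the origin. For $n,k\in\mathbb{N}$, $k$ treasures are hidden at unknown points $\mathbf{T}=(T_1,\dots,T_k)\in\mathcal{C}^k$, and $n$ robots start at time $0$ at the origin. Each robot moves independently anywhere in the plane (not restricted to $\mathcal{C}$) with speed at most $1$. A treasure is discovered when the position of some robot coincides with it; upon discovery all robots instantly learn its location. A strategy specifies the motion of all $n$ robots, where at each time the motion may depend only on the information about treasures discovered so far; $\mathcal{S}_k^n$ is the set of all valid strategies for $n$ robots and $k$ treasures. For $S\in\mathcal{S}_k^n$ let $\rho_S(\mathbf{T})$ be the time required until every robot has individually visited (been at the location of) every treasure. Define $$\rho_k^n=\inf_{S\in\mathcal{S}_k^n}\ \sup_{\mathbf{T}\in\mathcal{C}^k}\rho_S(\mathbf{T}).$$ Separately, let $R=(1,0)$ and let $d(\cdot,\cdot)$ denote Euclidean distance. For $k\in\mathbb{N}$ define $$c_k=\sup_{(T_1,\dots,T_k)\in\mathcal{C}^k}\ \min_\sigma\Big(d(R,T_{\sigma(1)})+\sum_{i=2}^k d(T_{\sigma(i-1)},T_{\sigma(i)})\Big),$$ the minimum being over all permutations $\sigma$ of $\{1,\dots,k\}$. *)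

theory Defs
  imports "HOL-Analysis.Analysis" "HOL-Combinatorics.Permutations"
begin

text \<open>
  The Euclidean plane is the type \<^typ>\<open>complex\<close>. Treasures are indexed by \<open>{1..k}\<close> and
  robots by \<open>{1..n}\<close>.
\<close>

definition placements :: "nat \<Rightarrow> (nat \<Rightarrow> complex) set" where
  "placements k = {1..k} \<rightarrow>\<^sub>E sphere 0 1"

text \<open>
  A strategy is given by the motions it results in: \<open>S T i t\<close> is the position of robot \<open>i\<close> at
  time \<open>t\<close> when the treasures are hidden at \<open>T\<close>. That the robots do not know \<open>T\<close> in advance is
  expressed by the last condition of \<open>strategies\<close> below.
\<close>

type_synonym strategy = "(nat \<Rightarrow> complex) \<Rightarrow> nat \<Rightarrow> real \<Rightarrow> complex"

definition discovered :: "nat \<Rightarrow> strategy \<Rightarrow> (nat \<Rightarrow> complex) \<Rightarrow> real \<Rightarrow> nat \<Rightarrow> bool" where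
  "discovered n S T t j \<longleftrightarrow> (\<exists>i\<in>{1..n}. \<exists>s\<in>{0..t}. S T i s = T j)"

text \<open>The locations known to all robots at time \<open>t\<close>.\<close>

definition known :: "nat \<Rightarrow> nat \<Rightarrow> strategy \<Rightarrow> (nat \<Rightarrow> complex) \<Rightarrow> real \<Rightarrow> nat \<Rightarrow> complex option" where
  "known n k S T t = (\<lambda>j. if j \<in> {1..k} \<and> discovered n S T t j then Some (T j) else None)"

text \<open>
  The last condition says that the positions at time \<open>t\<close> are a function of the history of
  discoveries during \<open>{0..t}\<close>, that is, of which treasures were found, when and where.
  Since motions are continuous and there are finitely many treasures, it makes no difference
  whether discoveries made at time \<open>t\<close> itself are counted as part of this history.
\<close>

definition strategies :: "nat \<Rightarrow> nat \<Rightarrow> strategy set" where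
  "strategies n k = {S.
     (\<forall>T\<in>placements k. \<forall>i\<in>{1..n}. S T i 0 = 0 \<and> 1-lipschitz_on {0..} (S T i)) \<and>
     (\<forall>T\<in>placements k. \<forall>T'\<in>placements k. \<forall>t\<ge>0.
        (\<forall>s\<in>{0..t}. known n k S T s = known n k S T' s) \<longrightarrow>
        (\<forall>i\<in>{1..n}. S T i t = S T' i t))}"

text \<open>
  The time is infinite (\<open>Inf {} = \<infinity>\<close>) if some robot never visits some treasure.
\<close>

definition completion_time :: "nat \<Rightarrow> nat \<Rightarrow> strategy \<Rightarrow> (nat \<Rightarrow> complex) \<Rightarrow> ereal" where
  "completion_time n k S T =
     Inf (ereal ` {t. 0 \<le> t \<and> (\<forall>i\<in>{1..n}. \<forall>j\<in>{1..k}. \<exists>s\<in>{0..t}. S T i s = T j)})"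

definition rho :: "nat \<Rightarrow> nat \<Rightarrow> ereal" where
  "rho n k = (INF S\<in>strategies n k. SUP T\<in>placements k. completion_time n k S T)"

definition route_length :: "nat \<Rightarrow> (nat \<Rightarrow> complex) \<Rightarrow> (nat \<Rightarrow> nat) \<Rightarrow> real" where
  "route_length k T \<sigma> =
     dist (Complex 1 0) (T (\<sigma> 1)) + (\<Sum>i=2..k. dist (T (\<sigma> (i - 1))) (T (\<sigma> i)))"

definition shortest_route :: "nat \<Rightarrow> (nat \<Rightarrow> complex) \<Rightarrow> real" where
  "shortest_route k T = Min (route_length k T ` {\<sigma>. \<sigma> permutes {1..k}})"

definition c_route :: "nat \<Rightarrow> real" where
  "c_route k = (SUP T\<in>placements k. shortest_route k T)"

text \<open>The supremum defining \<open>c_route k\<close> is over a nonempty set that is bounded above.\<close>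

lemma placements_nonempty: "placements k \<noteq> {}"
proof -
  have "(1::complex) \<in> sphere 0 1" by simp
  then show ?thesis unfolding placements_def PiE_eq_empty_iff by blast
qed

lemma bdd_above_shortest_route:
  assumes "k \<ge> 1"
  shows "bdd_above (shortest_route k ` placements k)"
proof (rule bdd_aboveI2)
  fix T assume T: "T \<in> placements k"
  have n1: "norm (T j) = 1" if "j \<in> {1..k}" for j
    using T that by (auto simp: placements_def dest: PiE_mem)
  have d: "dist (T a) (T b) \<le> 2" if "a \<in> {1..k}" "b \<in> {1..k}" for a b
    using norm_triangle_ineq4[of "T a" "T b"] n1[OF that(1)] n1[OF that(2)]
    by (simp add: dist_norm)
  have fin: "finite (route_length k T ` {\<sigma>. \<sigma> permutes {1..k}})"
    by (simp add: finite_permutations)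
  have "shortest_route k T \<le> route_length k T id"
    unfolding shortest_route_def by (rule Min_le[OF fin]) (auto simp: permutes_id)
  also have "\<dots> \<le> 2 + (\<Sum>i=2..k. 2)"
  proof -
    have "dist (Complex 1 0) (T 1) \<le> 2"
      using norm_triangle_ineq4[of "Complex 1 0" "T 1"] n1[of 1] assms
      by (simp add: dist_norm cmod_def)
    moreover have "(\<Sum>i=2..k. dist (T (i - 1)) (T i)) \<le> (\<Sum>i=2..k. 2)"
      by (rule sum_mono, rule d) auto
    ultimately show ?thesis by (simp add: route_length_def)
  qed
  finally show "shortest_route k T \<le> 2 + (\<Sum>i=2..k. 2)" .
qed

end

theory Submission imports Defs begin

text \<open>
  Until a robot first meets the unit circle, the motion cannot depend on the placement. So the
  first point \<open>P\<close> of the circle that is met, at a time \<open>t\<^sub>0 \<ge> 1\<close>, is the same for all placements.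
  The adversary rotates a placement with a long shortest route so that the point \<open>R\<close> is moved
  to \<open>P\<close>: the robot that is at \<open>P\<close> at time \<open>t\<^sub>0\<close> still has to visit all treasures, in some order.
\<close>

text \<open>Serves to list the treasures in the order in which a robot visits them, with
  \<open>f\<close> as the visit time. Ties are harmless, since only monotonicity is used.\<close>

lemma sorting_permutation:
  fixes f :: "nat \<Rightarrow> 'a::linorder"
  obtains \<sigma> where "\<sigma> permutes {1..k}" "mono_on {1..k} (f \<circ> \<sigma>)"
proof -
  define xs where "xs = sort_key f [1..<k+1]"
  \<comment> \<open>List positions start at 0 and treasure indices at 1, hence the shift. The
    identity outside \<open>{1..k}\<close> is what \<open>permutes\<close> demands.\<close>
  define \<sigma> where "\<sigma> = (\<lambda>i. if i \<in> {1..k} then xs ! (i - 1) else i)"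
  have len: "length xs = k" by (simp add: xs_def)
  have set_xs: "set xs = {1..k}" by (auto simp: xs_def)
  have "distinct xs" by (simp add: xs_def)
  then have "bij_betw ((!) xs) {0..<k} {1..k}"
    using bij_betw_nth[of xs "{0..<k}" "{1..k}"] len set_xs by (simp add: lessThan_atLeast0)
  moreover have "bij_betw (\<lambda>i. i - 1) {1..k} {0..<k}"
    by (rule bij_betwI[where g = Suc]) auto
  ultimately have "bij_betw ((!) xs \<circ> (\<lambda>i. i - 1)) {1..k} {1..k}"
    using bij_betw_trans by blast
  then have "bij_betw \<sigma> {1..k} {1..k}"
    by (rule bij_betw_cong[THEN iffD1, rotated]) (simp add: \<sigma>_def)
  then have "\<sigma> permutes {1..k}"
    by (rule bij_imp_permutes) (auto simp: \<sigma>_def)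
  moreover have "mono_on {1..k} (f \<circ> \<sigma>)"
  proof (rule mono_onI)
    fix i j assume "i \<in> {1..k}" "j \<in> {1..k}" "i \<le> j"
    moreover have "sorted (map f xs)" by (simp add: xs_def)
    ultimately show "(f \<circ> \<sigma>) i \<le> (f \<circ> \<sigma>) j"
      using sorted_nth_mono[of "map f xs" "i - 1" "j - 1"] len by (auto simp: \<sigma>_def)
  qed
  ultimately show thesis by (rule that)
qed

lemma sum_increments:
  fixes g :: "nat \<Rightarrow> real"
  assumes "k \<ge> 1"
  shows "(\<Sum>i=2..k. g i - g (i - 1)) = g k - g 1"
  using assms
proof (induction k rule: dec_induct)
  case base
  show ?case by simp
next
  case (step m)
  have "(\<Sum>i=2..Suc m. g i - g (i - 1)) = (\<Sum>i=2..m. g i - g (i - 1)) + (g (Suc m) - g m)"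
    using step.hyps by (subst sum.cl_ivl_Suc) simp
  with step.IH show ?case by linarith
qed

text \<open>Ordering the treasures by visit time turns the motion into a route. Speed at most 1
  bounds each leg by the time spent on it, and these times telescope. Multiplication by
  \<open>P\<close> is a rotation, so the lengths agree with those of the unrotated route.\<close>

lemma shortest_route_le_duration:
  assumes lip: "1-lipschitz_on {0..} f" and k: "k \<ge> 1" and a: "0 \<le> a"
    and start: "f a = P" and P: "norm P = 1"
    and visit: "\<And>j. j \<in> {1..k} \<Longrightarrow> \<exists>s\<in>{a..b}. f s = P * T j"
  shows "shortest_route k T \<le> b - a"
proof -
  obtain s where s: "\<And>j. j \<in> {1..k} \<Longrightarrow> s j \<in> {a..b} \<and> f (s j) = P * T j"
    using visit by metis
  obtain \<sigma> where \<sigma>: "\<sigma> permutes {1..k}" and mono: "mono_on {1..k} (s \<circ> \<sigma>)"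
    by (rule sorting_permutation)
  have \<sigma>_in: "\<sigma> i \<in> {1..k}" if "i \<in> {1..k}" for i
    using permutes_in_image[OF \<sigma>] that by blast
  have rotate: "dist (P * x) (P * y) = dist x y" for x y
    using P by (simp add: dist_norm norm_mult flip: right_diff_distrib)
  have speed: "dist (f u) (f v) \<le> v - u" if "0 \<le> u" "u \<le> v" for u v
    using lipschitz_onD[OF lip, of u v] that by (simp add: dist_real_def)
  \<comment> \<open>The point \<open>Complex 1 0\<close> is the number 1, so the rotation by
    \<open>P\<close> takes it to \<open>P\<close>, the position at time \<open>a\<close>.\<close>
  have "dist (Complex 1 0) (T (\<sigma> 1)) = dist (f a) (f (s (\<sigma> 1)))"
    using s[OF \<sigma>_in[of 1]] k start rotate[of "Complex 1 0" "T (\<sigma> 1)"]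
    by (simp flip: one_complex.code)
  also have "\<dots> \<le> s (\<sigma> 1) - a"
    using s[OF \<sigma>_in[of 1]] k a by (intro speed) auto
  finally have first: "dist (Complex 1 0) (T (\<sigma> 1)) \<le> s (\<sigma> 1) - a" .
  have step: "dist (T (\<sigma> (i - 1))) (T (\<sigma> i)) \<le> s (\<sigma> i) - s (\<sigma> (i - 1))" if "i \<in> {2..k}" for i
  proof -
    have i: "i - 1 \<in> {1..k}" "i \<in> {1..k}" using that by auto
    have "dist (T (\<sigma> (i - 1))) (T (\<sigma> i)) = dist (f (s (\<sigma> (i - 1)))) (f (s (\<sigma> i)))"
      using s[OF \<sigma>_in[OF i(1)]] s[OF \<sigma>_in[OF i(2)]] rotate by simp
    also have "\<dots> \<le> s (\<sigma> i) - s (\<sigma> (i - 1))"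
      using s[OF \<sigma>_in[OF i(1)]] a mono_onD[OF mono i] by (intro speed) auto
    finally show ?thesis .
  qed
  have "shortest_route k T \<le> route_length k T \<sigma>"
    unfolding shortest_route_def using \<sigma> by (intro Min_le) (auto simp: finite_permutations)
  also have "\<dots> \<le> (s (\<sigma> 1) - a) + (\<Sum>i=2..k. s (\<sigma> i) - s (\<sigma> (i - 1)))"
    unfolding route_length_def using first step by (intro add_mono sum_mono)
  also have "\<dots> = s (\<sigma> k) - a"
    using sum_increments[OF k, of "\<lambda>i. s (\<sigma> i)"] by simp
  also have "\<dots> \<le> b - a"
    using s[OF \<sigma>_in[of k]] k by auto
  finally show ?thesis .
qed

text \<open>All points of the circle count, not only the treasures, so the placement enters only
  through the motion. Every visit to a treasure happens at such a time.\<close>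

definition circle_times :: "nat \<Rightarrow> strategy \<Rightarrow> (nat \<Rightarrow> complex) \<Rightarrow> real set" where
  "circle_times n S T = {t. 0 \<le> t \<and> (\<exists>i\<in>{1..n}. norm (S T i t) = 1)}"

lemma strategy_start:
  "S \<in> strategies n k \<Longrightarrow> T \<in> placements k \<Longrightarrow> i \<in> {1..n} \<Longrightarrow> S T i 0 = 0"
  unfolding strategies_def by blast

lemma strategy_lipschitz:
  "S \<in> strategies n k \<Longrightarrow> T \<in> placements k \<Longrightarrow> i \<in> {1..n} \<Longrightarrow> 1-lipschitz_on {0..} (S T i)"
  unfolding strategies_def by blast

lemma strategy_causal:
  assumes "S \<in> strategies n k" "T \<in> placements k" "T' \<in> placements k" "0 \<le> t"
    and "\<forall>s\<in>{0..t}. known n k S T s = known n k S T' s" and "i \<in> {1..n}"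
  shows "S T i t = S T' i t"
proof -
  have "\<forall>T\<in>placements k. \<forall>T'\<in>placements k. \<forall>t\<ge>0.
      (\<forall>s\<in>{0..t}. known n k S T s = known n k S T' s) \<longrightarrow> (\<forall>i\<in>{1..n}. S T i t = S T' i t)"
    using assms(1) unfolding strategies_def by (elim CollectE conjE)
  with assms(2-6) show ?thesis by blast
qed

lemma norm_placement: "T \<in> placements k \<Longrightarrow> j \<in> {1..k} \<Longrightarrow> norm (T j) = 1"
  by (auto simp: placements_def dest: PiE_mem)

lemma visit_circle_times:
  assumes "T \<in> placements k" "i \<in> {1..n}" "j \<in> {1..k}" "0 \<le> t" "S T i t = T j"
  shows "t \<in> circle_times n S T"
  unfolding circle_times_def using assms(2,4,5) norm_placement[OF assms(1,3)]
  by (intro CollectI conjI bexI[of _ i]) simp_all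

text \<open>By continuity these times form a closed set, bounded below by 0, so the infimum is
  attained.\<close>

lemma circle_times_first:
  assumes S: "S \<in> strategies n k" and T: "T \<in> placements k" and ne: "circle_times n S T \<noteq> {}"
  obtains t where "t \<in> circle_times n S T" "\<And>s. s \<in> circle_times n S T \<Longrightarrow> t \<le> s"
proof -
  have eq: "circle_times n S T = (\<Union>i\<in>{1..n}. {0..} \<inter> (\<lambda>t. norm (S T i t)) -` {1})"
    by (auto simp: circle_times_def)
  have "closed (circle_times n S T)"
    unfolding eq
  proof (intro closed_UN ballI)
    fix i assume "i \<in> {1..n}"
    then have "continuous_on {0..} (\<lambda>t. norm (S T i t))"
      by (intro continuous_on_norm lipschitz_on_continuous_on[OF strategy_lipschitz[OF S T]])
    then have "closed ((\<lambda>t. norm (S T i t)) -` {1} \<inter> {0..})"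
      by (rule continuous_on_closed_vimage[THEN iffD1, rule_format, rotated]) auto
    then show "closed ({0..} \<inter> (\<lambda>t. norm (S T i t)) -` {1})" by (simp add: Int_commute)
  qed simp
  moreover have bdd: "bdd_below (circle_times n S T)"
    by (rule bdd_belowI[of _ 0]) (auto simp: circle_times_def)
  ultimately have "Inf (circle_times n S T) \<in> circle_times n S T"
    using ne by (intro closed_contains_Inf)
  then show thesis using cInf_lower[OF _ bdd] by (rule that)
qed

text \<open>Strictly before \<open>u\<close> nothing is discovered under either placement, so
  causality makes the motions agree. At \<open>u\<close> itself a discovery may occur, and there the
  equality follows by continuity.\<close>

lemma eq_before_circle:
  assumes S: "S \<in> strategies n k" and T: "T \<in> placements k" and T': "T' \<in> placements k"
    and i: "i \<in> {1..n}" and u: "0 \<le> u"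
    and free: "\<And>t. t \<in> circle_times n S T \<Longrightarrow> u \<le> t" "\<And>t. t \<in> circle_times n S T' \<Longrightarrow> u \<le> t"
  shows "S T i u = S T' i u"
\<comment> \<open>For \<open>u = 0\<close> the interval \<open>{0..<u}\<close> is empty and has no
  limit point to extend to; the common start at the origin replaces the argument.\<close>
proof (cases "u = 0")
  case True
  then show ?thesis using strategy_start[OF S _ i] T T' by simp
next
  case False
  have known_empty: "known n k S X t = (\<lambda>_. None)"
    if X: "X \<in> placements k" and t: "t < u" and X_free: "\<And>t. t \<in> circle_times n S X \<Longrightarrow> u \<le> t" for X t
  proof -
    have "\<not> discovered n S X t j" if j: "j \<in> {1..k}" for j
    proof
      assume "discovered n S X t j"
      then obtain i s where "i \<in> {1..n}" "s \<in> {0..t}" "S X i s = X j"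
        by (auto simp: discovered_def)
      then have "s \<in> circle_times n S X"
        using visit_circle_times[OF X _ j] by simp
      then show False using X_free[of s] \<open>s \<in> {0..t}\<close> t by simp
    qed
    then show ?thesis by (auto simp: known_def)
  qed
  have eq: "S T i t = S T' i t" if "t \<in> {0..<u}" for t
  proof -
    have "\<forall>s\<in>{0..t}. known n k S T s = known n k S T' s"
      using known_empty[OF T _ free(1)] known_empty[OF T' _ free(2)] that by simp
    then show ?thesis using strategy_causal[OF S T T' _ _ i] that by simp
  qed
  have cont: "continuous_on {0..u} (S X i)" if "X \<in> placements k" for X
    using lipschitz_on_continuous_on[OF strategy_lipschitz[OF S that i]]
    by (rule continuous_on_subset) auto
  have "continuous_on {0..u} (\<lambda>t. S T i t - S T' i t)"
    by (intro continuous_on_diff cont T T')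
  moreover have "closure {0..<u} = {0..u}" using u False by simp
  ultimately have "S T i u - S T' i u = 0"
    using continuous_constant_on_closure[of "{0..<u}" "\<lambda>t. S T i t - S T' i t" 0 u] eq u
    by simp
  then show ?thesis by simp
qed

text \<open>If the circle were met under \<open>T'\<close> at a first time \<open>u < t\<close>, the
  motions would agree at \<open>u\<close>, and the circle would be met under \<open>T\<close> before
  \<open>t\<close> as well.\<close>

lemma first_circle_time_independent:
  assumes S: "S \<in> strategies n k" and T: "T \<in> placements k" and T': "T' \<in> placements k"
    and first: "\<And>s. s \<in> circle_times n S T \<Longrightarrow> t \<le> s" and s: "s \<in> circle_times n S T'"
  shows "t \<le> s"
proof -
  obtain u where u: "u \<in> circle_times n S T'" "\<And>s. s \<in> circle_times n S T' \<Longrightarrow> u \<le> s"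
    using circle_times_first[OF S T'] s by blast
  have "t \<le> u"
  proof (rule ccontr)
    assume "\<not> t \<le> u"
    then have "S T i u = S T' i u" if "i \<in> {1..n}" for i
      using eq_before_circle[OF S T T' that, of u] u first
      by (force simp: circle_times_def)
    then have "u \<in> circle_times n S T" using u(1) by (auto simp: circle_times_def)
    then show False using first \<open>\<not> t \<le> u\<close> by blast
  qed
  then show ?thesis using u(2)[OF s] by simp
qed

lemma exists_slow_placement:
  assumes n: "n \<ge> 1" and k: "k \<ge> 1" and S: "S \<in> strategies n k" and T: "T \<in> placements k"
  shows "\<exists>T'\<in>placements k. ereal (1 + shortest_route k T) \<le> completion_time n k S T'"
\<comment> \<open>If no robot ever meets the circle, \<open>T\<close> itself is never fully visited
  and takes infinite time.\<close>
proof (cases "circle_times n S T = {}")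
  case True
  have "{t. 0 \<le> t \<and> (\<forall>i\<in>{1..n}. \<forall>j\<in>{1..k}. \<exists>s\<in>{0..t}. S T i s = T j)} = {}"
  proof (rule equals0I)
    fix t assume "t \<in> {t. 0 \<le> t \<and> (\<forall>i\<in>{1..n}. \<forall>j\<in>{1..k}. \<exists>s\<in>{0..t}. S T i s = T j)}"
    then obtain s where "s \<in> {0..t}" "S T 1 s = T 1" using n k by fastforce
    then have "s \<in> circle_times n S T"
      using visit_circle_times[OF T, of 1 n 1 s] n k by simp
    then show False using True by blast
  qed
  then have "completion_time n k S T = \<infinity>"
    unfolding completion_time_def by (simp only: image_empty Inf_empty top_ereal_def)
  then show ?thesis using T by (intro bexI[of _ T]) simp_all
next
  case False
  obtain t0 where t0: "t0 \<in> circle_times n S T" "\<And>s. s \<in> circle_times n S T \<Longrightarrow> t0 \<le> s"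
    using circle_times_first[OF S T False] by metis
  then obtain i where i: "i \<in> {1..n}" and P1: "norm (S T i t0) = 1" and "0 \<le> t0"
    by (auto simp: circle_times_def)
  define P where "P = S T i t0"
  \<comment> \<open>The rotation taking 1 to \<open>P\<close>, restricted to \<open>{1..k}\<close>
    because placements are extensional functions.\<close>
  define T' where "T' = (\<lambda>j\<in>{1..k}. P * T j)"
  have T': "T' \<in> placements k"
    using P1 norm_placement[OF T] by (auto simp: placements_def T'_def P_def norm_mult)
  have free: "t0 \<le> s" if "s \<in> circle_times n S T'" for s
    by (rule first_circle_time_independent[OF S T T' t0(2) that])
  have P: "S T' i t0 = P"
    using eq_before_circle[OF S T T' i \<open>0 \<le> t0\<close> t0(2) free] by (simp add: P_def)
  \<comment> \<open>Reaching norm 1 from the origin at speed at most 1 takes time at least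
    1.\<close>
  have "1 \<le> t0"
    using lipschitz_onD[OF strategy_lipschitz[OF S T i], of t0 0] strategy_start[OF S T i] P1 \<open>0 \<le> t0\<close>
    by (simp add: dist_norm)
  have "ereal (1 + shortest_route k T) \<le> completion_time n k S T'"
    unfolding completion_time_def
  proof (intro INF_greatest, clarsimp)
    fix t assume "0 \<le> t"
      and all: "\<forall>i\<in>{Suc 0..n}. \<forall>j\<in>{Suc 0..k}. \<exists>s\<in>{0..t}. S T' i s = T' j"
    have "shortest_route k T \<le> t - t0"
    proof (rule shortest_route_le_duration[OF strategy_lipschitz[OF S T' i] k \<open>0 \<le> t0\<close> P])
      show "norm P = 1" using P1 by (simp add: P_def)
    next
      fix j assume j: "j \<in> {1..k}"
      then obtain s where s: "s \<in> {0..t}" "S T' i s = T' j"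
        using all i by fastforce
      \<comment> \<open>Treasures lie on the circle, so no visit precedes \<open>t0\<close>, and all
        of the tour by robot \<open>i\<close> fits into \<open>{t0..t}\<close>.\<close>
      then have "s \<in> circle_times n S T'"
        using visit_circle_times[OF T' i j] by simp
      then show "\<exists>s\<in>{t0..t}. S T' i s = P * T j"
        using free s j by (auto simp: T'_def)
    qed
    then show "1 + shortest_route k T \<le> t" using \<open>1 \<le> t0\<close> by simp
  qed
  then show ?thesis using T' by blast
qed

theorem lemma13:
  fixes n k :: nat
  assumes "n \<ge> 1" and "k \<ge> 1"
  shows "rho n k \<ge> ereal (1 + c_route k)"
  unfolding rho_def
proof (rule INF_greatest)
  fix S assume S: "S \<in> strategies n k"
  let ?X = "SUP T\<in>placements k. completion_time n k S T"
  have le: "ereal (1 + shortest_route k T) \<le> ?X" if "T \<in> placements k" for T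
    using exists_slow_placement[OF assms S that] by (meson SUP_upper2)
  show "ereal (1 + c_route k) \<le> ?X"
  \<comment> \<open>\<open>c_route k\<close> is a supremum of reals while \<open>?X\<close> is
    extended real, so the bound passes to the supremum only when \<open>?X\<close> is finite. The
    value minus infinity contradicts \<open>le\<close> at any placement.\<close>
  proof (cases ?X)
    case (real x)
    have "c_route k \<le> x - 1"
      unfolding c_route_def
    proof (rule cSUP_least[OF placements_nonempty])
      fix T assume "T \<in> placements k"
      from le[OF this] show "shortest_route k T \<le> x - 1" unfolding real by simp
    qed
    then show ?thesis unfolding real by simp
  next
    case PInf
    then show ?thesis by simp
  next
    case MInf
    then show ?thesis using le placements_nonempty[of k] by auto
  qed
qed

end
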